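(* There exist absolute constants $c_1, c_2 > 0$ such that for all integers $d$ and $k$ with $1 \le k \le c_1\sqrt{d}$, the instance $\Delta[k,d]$ on $Q_d$ contains at least $c_2\,\frac{k}{d}\,|E_d|$ pairwise edge-disjoint inconsistent cycles.
   Context: The $d$-dimensional hypercube $Q_d = (V_d, E_d)$ has vertex set $V_d = \{0,1\}^d$ (coordinates indexed $1,\dots,d$), and two vertices are joined by an edge iff they differ in exactly one coordinate; for an edge $e=\{v_1,v_2\}$ let $i(e)$ be that coordinate. A Max-2-LIN$(\mathbb{Z}_2)$ instance on $Q_d$ is a function $I : E_d \to \{0,1\}$; edges with $I(e)=0$ are equality edges and edges with $I(e)=1$ are inequality edges. An assignment $\sigma : V_d \to \{0,1\}$ satisfies an equality edge $\{u,v\}$ if $\sigma(u)=\sigma(v)$ and an inequality edge if $\sigma(u)\neq\sigma(v)$. A cycle in $Q_d$ is inconsistent (for the instance) if no assignment satisfies all edges of the cycle. For a vertex $v$ let $H(v[k])$ denote the number of coordinates $j \in \{k+1,\dots,d\}$ with $v_j = 1$. The instance $\Delta[k,d] : E_d \to \{0,1\}$ is defined as follows: for an edge $e = \{v_1,v_2\}$, if $i(e) > k$ then $\Delta[k,d](e)=0$; if $i(e)\le k$ and $H(v_1[k]) > \frac{d-k}{2}$ then $\Delta[k,d](e) = 0$; otherwise $\Delta[k,d](e)=1$. (When $i(e)\le k$, $v_1$ and $v_2$ agree on coordinates $k+1,\dots,d$, so this is well defined.) *)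

theory Defs
  imports Complex_Main "HOL-Library.FuncSet"
begin

type_synonym vertex = "nat \<Rightarrow> nat"

definition cube_vertices :: "nat \<Rightarrow> vertex set" where
  "cube_vertices d = {1..d} \<rightarrow>\<^sub>E {0, 1}"

definition cube_edges :: "nat \<Rightarrow> vertex set set" where
  "cube_edges d = {{u, v} | u v. u \<in> cube_vertices d \<and> v \<in> cube_vertices d \<and>
     (\<exists>!j. j \<in> {1..d} \<and> u j \<noteq> v j)}"

text \<open>The coordinate \<open>i(e)\<close>. Vertices are extensional functions, so the two ends
  of an edge cannot differ outside \<open>{1..d}\<close>, and \<open>d\<close> need not be an argument.\<close>

definition edge_dir :: "vertex set \<Rightarrow> nat" where
  "edge_dir e = (THE j. \<exists>u v. e = {u, v} \<and> u j \<noteq> v j)"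

text \<open>An instance on the cube is a function in \<open>instances d\<close>; only its values on the
  edges matter.\<close>

definition instances :: "nat \<Rightarrow> (vertex set \<Rightarrow> nat) set" where
  "instances d = cube_edges d \<rightarrow> {0, 1}"

definition assignments :: "nat \<Rightarrow> (vertex \<Rightarrow> nat) set" where
  "assignments d = cube_vertices d \<rightarrow> {0, 1}"

definition satisfies :: "(vertex set \<Rightarrow> nat) \<Rightarrow> (vertex \<Rightarrow> nat) \<Rightarrow> vertex set \<Rightarrow> bool" where
  "satisfies I \<sigma> e \<longleftrightarrow> (\<forall>u v. e = {u, v} \<longrightarrow>
     (I e = 0 \<longrightarrow> \<sigma> u = \<sigma> v) \<and> (I e = 1 \<longrightarrow> \<sigma> u \<noteq> \<sigma> v))"

text \<open>A (simple) cycle is given by its vertices in cyclic order. Lists that differ by a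
  rotation or a reversal describe the same cycle; they have the same set of edges.\<close>

definition cycle_edges :: "vertex list \<Rightarrow> vertex set set" where
  "cycle_edges vs = {{vs ! j, vs ! (Suc j mod length vs)} | j. j < length vs}"

definition is_cycle :: "nat \<Rightarrow> vertex list \<Rightarrow> bool" where
  "is_cycle d vs \<longleftrightarrow> 3 \<le> length vs \<and> distinct vs \<and> set vs \<subseteq> cube_vertices d \<and>
     cycle_edges vs \<subseteq> cube_edges d"

definition inconsistent :: "nat \<Rightarrow> (vertex set \<Rightarrow> nat) \<Rightarrow> vertex list \<Rightarrow> bool" where
  "inconsistent d I vs \<longleftrightarrow>
     \<not> (\<exists>\<sigma> \<in> assignments d. \<forall>e \<in> cycle_edges vs. satisfies I \<sigma> e)"

definition upper_weight :: "nat \<Rightarrow> nat \<Rightarrow> vertex \<Rightarrow> nat" where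
  "upper_weight k d v = card {j \<in> {k+1..d}. v j = 1}"

text \<open>When \<open>edge_dir e \<le> k\<close>, both ends of \<open>e\<close> have the same upper weight
  (lemma \<open>upper_weight_edge\<close>), so the quantifier over the ends is immaterial.\<close>

definition Delta :: "nat \<Rightarrow> nat \<Rightarrow> vertex set \<Rightarrow> nat" where
  "Delta k d e =
     (if edge_dir e > k then 0
      else if \<exists>v \<in> e. real (upper_weight k d v) > (real d - real k) / 2 then 0
      else 1)"

lemma edge_dir_eq:
  assumes "u \<in> cube_vertices d" "v \<in> cube_vertices d"
    and "\<exists>!j. j \<in> {1..d} \<and> u j \<noteq> v j" and "u i \<noteq> v i"
  shows "edge_dir {u, v} = i" and "i \<in> {1..d}"
proof -
  have out: "u j = v j" if "j \<notin> {1..d}" for j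
    using assms(1,2) that PiE_arb unfolding cube_vertices_def by metis
  show "i \<in> {1..d}" using out assms(4) by blast
  have uniq: "j = i" if "u j \<noteq> v j" for j
    using out assms(3,4) that by blast
  show "edge_dir {u, v} = i"
    unfolding edge_dir_def
  proof (rule the_equality)
    show "\<exists>a b. {u, v} = {a, b} \<and> a i \<noteq> b i" using assms(4) by blast
    show "j = i" if "\<exists>a b. {u, v} = {a, b} \<and> a j \<noteq> b j" for j
      using that uniq by (metis doubleton_eq_iff)
  qed
qed

lemma upper_weight_edge:
  assumes "{u, v} \<in> cube_edges d" and "edge_dir {u, v} \<le> k"
  shows "upper_weight k d u = upper_weight k d v"
proof -
  obtain a b where ab: "{u, v} = {a, b}" "a \<in> cube_vertices d" "b \<in> cube_vertices d"
    "\<exists>!j. j \<in> {1..d} \<and> a j \<noteq> b j"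
    using assms(1) unfolding cube_edges_def by blast
  have "a j = b j" if "j \<in> {k+1..d}" for j
    using edge_dir_eq(1)[OF ab(2-4), of j] assms(2) ab(1) that by fastforce
  then have "upper_weight k d a = upper_weight k d b"
    unfolding upper_weight_def by (metis (mono_tags, lifting))
  then show ?thesis using ab(1) by (metis doubleton_eq_iff)
qed

lemma Delta_edge:
  assumes "{u, v} \<in> cube_edges d"
  shows "Delta k d {u, v} =
    (if edge_dir {u, v} \<le> k \<and> real (upper_weight k d u) \<le> (real d - real k) / 2
     then 1 else 0)"
  using upper_weight_edge[OF assms] unfolding Delta_def by auto

lemma Delta_instance: "Delta k d \<in> instances d"
  unfolding instances_def Delta_def by auto

end

theory Submission imports Defs begin

text \<open>
  Write \<open>m = (d - k) div 2\<close> and view \<open>2m\<close> of the upper coordinates as a cube. At every vertex \<open>z\<close>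
  of that cube link as many incoming (upward) edges as possible injectively to outgoing ones. Below
  the middle level every incoming edge is linked and above it every outgoing edge is, so the edges
  decompose into monotone paths. A vertex at depth \<open>s\<close> below the middle is the start of \<open>2s\<close>
  paths, one at height \<open>s\<close> above the middle the end of \<open>2s\<close> paths. With \<open>S\<close> about
  \<open>sqrt (3m)\<close>, at least half as many paths as there are edges next to the middle level both start
  and end within distance \<open>S\<close> of the middle. A maximal conflict-free selection then gives
  paths directions \<open>i \<le> k\<close> such that paths with the same direction have different starts and
  different ends, with \<open>k 2^(2m)\<close> paths selected up to a constant factor. A selected path with direction \<open>i\<close>,
  followed upwards in one copy \<open>x\<close> of the cube and downwards in the adjacent copy
  \<open>insert i x\<close>, is a cycle with exactly one inequality edge.
\<close>

section \<open>Binomial coefficients near the middle\<close>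

text \<open>Squaring removes the root: the induction bounds \<open>16 ^ m\<close> by
  \<open>4 * m\<close> times the squared central coefficient, and its step reduces to
  \<open>4 * m * (m + 1) \<le> (2 * m + 1)\<^sup>2\<close>.\<close>

lemma central_binomial_sqrt_bound:
  assumes "m \<ge> 1"
  shows "4 ^ m \<le> 2 * sqrt m * ((2 * m) choose m)"
proof -
  have "(16::real) ^ m \<le> 4 * m * real ((2 * m) choose m) ^ 2"
    using assms
  proof (induction m rule: dec_induct)
    case base
    then show ?case by simp
  next
    case (step m)
    define c where "c = real ((2 * m) choose m)"
    have "Suc m * ((2 * Suc m) choose (Suc m)) = 2 * Suc (2 * m) * ((2 * m) choose m)"
    proof -
      have "Suc m * ((2 * Suc m) choose (Suc m)) = (2 * Suc m) * (Suc (2 * m) choose m)"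
        using Suc_times_binomial_eq[of "Suc (2*m)" m] by simp
      also have "Suc (2 * m) choose m = Suc (2 * m) choose Suc m"
        by (subst binomial_symmetric) auto
      also have "(2 * Suc m) * \<dots> = 2 * (Suc m * (Suc (2 * m) choose Suc m))" by simp
      also have "\<dots> = 2 * (Suc (2 * m) * ((2 * m) choose m))"
        using Suc_times_binomial_eq[of "2*m" m] by (metis mult.commute)
      finally show ?thesis by simp
    qed
    then have "(m + 1) * real ((2 * Suc m) choose (Suc m)) = 2 * (2 * m + 1) * c"
      unfolding c_def by (metis Suc_eq_plus1 of_nat_mult)
    then have r: "real ((2 * Suc m) choose (Suc m)) = 2 * (2 * m + 1) * c / (m + 1)"
      by (simp add: field_simps)
    have "(16::real) ^ Suc m \<le> 16 * (4 * m * c\<^sup>2)"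
      using step.IH by (simp add: c_def)
    also have "\<dots> \<le> 4 * (Suc m) * (2 * (2 * m + 1) * c / (m + 1))\<^sup>2"
    proof -
      define r where "r = real m + 1"
      have "r > 0" "real (Suc m) = r" by (auto simp: r_def)
      then have "4 * real (Suc m) * (2 * (2 * real m + 1) * c / r)\<^sup>2 = 16 * (2 * real m + 1)\<^sup>2 * c\<^sup>2 / r"
        by (simp add: power_mult_distrib power_divide power2_eq_square) (simp add: algebra_simps)
      then have "4 * real (Suc m) * (2 * (2 * real m + 1) * c / (real m + 1))\<^sup>2
          = 16 * (2 * real m + 1)\<^sup>2 * c\<^sup>2 / (real m + 1)"
        by (simp add: r_def)
      moreover have "16 * (4 * real m * c\<^sup>2) * (real m + 1) \<le> 16 * (2 * real m + 1)\<^sup>2 * c\<^sup>2"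
        by (simp add: power2_eq_square algebra_simps)
      then have "16 * (4 * real m * c\<^sup>2) \<le> 16 * (2 * real m + 1)\<^sup>2 * c\<^sup>2 / (real m + 1)"
        by (subst pos_le_divide_eq) auto
      ultimately show ?thesis
        by (simp only: of_nat_mult of_nat_add of_nat_numeral of_nat_1)
    qed
    finally show ?case unfolding r .
  qed
  also have "\<dots> = (2 * sqrt m * ((2 * m) choose m))\<^sup>2"
    by (simp add: power_mult_distrib)
  also have "(16::real) ^ m = (4 ^ m)\<^sup>2"
    by (simp add: power2_eq_square flip: power_mult_distrib)
  finally show ?thesis by (rule power2_le_imp_le) simp
qed

text \<open>Consecutive coefficients have ratio \<open>(m - s) / (m + s + 1)\<close>, which is at
  most \<open>(m + s\<^sup>2) / (m + (Suc s)\<^sup>2)\<close>. The bound is meant for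
  \<open>s\<^sup>2\<close> at least \<open>3 * m\<close>, where the coefficient has fallen to a
  quarter of the central one.\<close>

lemma binomial_off_centre_bound:
  assumes "s \<le> m"
  shows "((2 * m) choose (m - s)) * (m + s\<^sup>2) \<le> m * ((2 * m) choose m)"
  using assms
proof (induction s)
  case 0
  then show ?case by simp
next
  case (Suc s)
  define a where "a = (2 * m) choose (m - s)"
  define b where "b = (2 * m) choose (m - Suc s)"
  obtain t where t: "m = Suc s + t" using Suc.prems le_Suc_ex by blast
  have "Suc t * a = (2 * m - t) * b"
    unfolding a_def b_def t
    by (metis add_Suc_right add_Suc_shift add_diff_cancel_left' binomial_absorb_comp
        binomial_absorption mult.commute)
  then have ab: "(m + s + 1) * b = (m - s) * a" using t by (simp add: algebra_simps)
  have "(m - s) * (m + (Suc s)\<^sup>2) \<le> (m + s + 1) * (m + s\<^sup>2)"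
    unfolding t by (simp add: power2_eq_square algebra_simps)
  then have "(m - s) * (m + (Suc s)\<^sup>2) * a \<le> (m + s + 1) * (m + s\<^sup>2) * a" by (rule mult_right_mono) simp
  then have "(m + s + 1) * (b * (m + (Suc s)\<^sup>2)) \<le> (m + s + 1) * (a * (m + s\<^sup>2))"
    using ab by (metis mult.assoc mult.commute)
  then have "b * (m + (Suc s)\<^sup>2) \<le> a * (m + s\<^sup>2)"
    by (metis Suc_eq_plus1 Suc_mult_le_cancel1)
  also have "\<dots> \<le> m * ((2 * m) choose m)" using Suc by (simp add: a_def)
  finally show ?case by (simp add: b_def)
qed

text \<open>The sum telescopes: its term at \<open>w\<close> is the number of cube edges leaving
  level \<open>w\<close> minus the number entering it, and the edges leaving level \<open>w\<close>
  are those entering level \<open>Suc w\<close>.\<close>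

lemma sum_binomial_band:
  assumes "S \<le> m"
  shows "(\<Sum>w = m - S..<m. (2 * m - 2 * w) * ((2 * m) choose w)) + (m - S) * ((2 * m) choose (m - S))
    = m * ((2 * m) choose m)"
  using assms
proof (induction S)
  case 0
  then show ?case by simp
next
  case (Suc S)
  define w where "w = m - Suc S"
  have w: "m - S = Suc w" "w < m" using Suc.prems by (auto simp: w_def)
  have "(\<Sum>v = w..<m. (2 * m - 2 * v) * ((2 * m) choose v))
      = (2 * m - 2 * w) * ((2 * m) choose w) + (\<Sum>v = Suc w..<m. (2 * m - 2 * v) * ((2 * m) choose v))"
    using w by (simp add: sum.atLeast_Suc_lessThan)
  moreover have "(2 * m - 2 * w) * ((2 * m) choose w) + w * ((2 * m) choose w) = Suc w * ((2 * m) choose Suc w)"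
  proof -
    have "(2 * m - 2 * w) * ((2 * m) choose w) + w * ((2 * m) choose w) = (2 * m - w) * ((2 * m) choose w)"
      using w by (simp add: add_mult_distrib[symmetric])
    then show ?thesis by (metis binomial_absorb_comp binomial_absorption mult.commute)
  qed
  ultimately show ?case using Suc w w_def by simp
qed

section \<open>Selection without conflicts\<close>

text \<open>In a maximal selection, an element left out is blocked for each of the labels, while a
  selected pair blocks at most \<open>2 * K\<close> elements.\<close>

lemma conflict_free_selection:
  fixes \<alpha> :: "'a \<Rightarrow> 'b" and \<beta> :: "'a \<Rightarrow> 'c" and I :: "'i set"
  assumes fin: "finite G" "finite I"
    and \<alpha>: "\<And>p. p \<in> G \<Longrightarrow> card {q \<in> G. \<alpha> q = \<alpha> p} \<le> K"
    and \<beta>: "\<And>p. p \<in> G \<Longrightarrow> card {q \<in> G. \<beta> q = \<beta> p} \<le> K"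
  obtains T where "T \<subseteq> G \<times> I" "inj_on fst T"
    "inj_on (\<lambda>(p, i). (\<alpha> p, i)) T" "inj_on (\<lambda>(p, i). (\<beta> p, i)) T"
    "card I * card G \<le> (card I + 2 * K) * card T"
proof -
  define ok where "ok T \<longleftrightarrow> T \<subseteq> G \<times> I \<and> inj_on fst T \<and>
    inj_on (\<lambda>(p, i). (\<alpha> p, i)) T \<and> inj_on (\<lambda>(p, i). (\<beta> p, i)) T" for T
  have "finite {T. ok T}"
    by (rule finite_subset[of _ "Pow (G \<times> I)"]) (use fin in \<open>auto simp: ok_def\<close>)
  moreover have "ok {}" by (simp add: ok_def)
  ultimately obtain T where T: "ok T" and max: "\<And>T'. ok T' \<Longrightarrow> T \<subseteq> T' \<Longrightarrow> T' = T"
    using finite_has_maximal[of "{T. ok T}"] by auto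
  have finT: "finite T" using T fin unfolding ok_def by (meson finite_SigmaI finite_subset)
  have sub: "fst ` T \<subseteq> G" using T by (auto simp: ok_def)
  have cardT: "card (fst ` T) = card T" using T by (simp add: ok_def card_image)
  let ?B = "\<lambda>(p, i). ({q \<in> G. \<alpha> q = \<alpha> p} \<union> {q \<in> G. \<beta> q = \<beta> p}) \<times> {i}"
  have "(G - fst ` T) \<times> I \<subseteq> (\<Union>t\<in>T. ?B t)"
  proof clarify
    fix p i assume p: "p \<in> G" "p \<notin> fst ` T" and i: "i \<in> I"
    have "(p, i) \<notin> T" using p by force
    then have "\<not> ok (insert (p, i) T)" using max[of "insert (p, i) T"] by auto
    then have "\<exists>q. (q, i) \<in> T \<and> (\<alpha> q = \<alpha> p \<or> \<beta> q = \<beta> p)"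
      using T p i unfolding ok_def by (force simp: inj_on_insert)
    then show "(p, i) \<in> (\<Union>t\<in>T. ?B t)" using p by fastforce
  qed
  then have "card ((G - fst ` T) \<times> I) \<le> card (\<Union>t\<in>T. ?B t)"
    by (rule card_mono[rotated]) (use fin finT in auto)
  also have "\<dots> \<le> (\<Sum>t\<in>T. card (?B t))" by (rule card_UN_le[OF finT])
  also have "\<dots> \<le> (\<Sum>t\<in>T. 2 * K)"
  proof (rule sum_mono, clarify)
    fix p i assume "(p, i) \<in> T"
    then have "p \<in> G" using T by (auto simp: ok_def)
    then show "card (({q \<in> G. \<alpha> q = \<alpha> p} \<union> {q \<in> G. \<beta> q = \<beta> p}) \<times> {i}) \<le> 2 * K"
      using card_Un_le[of "{q \<in> G. \<alpha> q = \<alpha> p}" "{q \<in> G. \<beta> q = \<beta> p}"] \<alpha>[of p] \<beta>[of p]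
      by (simp add: card_cartesian_product)
  qed
  finally have "(card G - card T) * card I \<le> 2 * K * card T"
    using sub cardT fin finT by (simp add: card_cartesian_product card_Diff_subset mult.commute)
  moreover have "card T \<le> card G" using card_mono[OF fin(1) sub] cardT by simp
  ultimately have "card I * card G \<le> (card I + 2 * K) * card T"
    by (simp add: algebra_simps diff_mult_distrib)
  then show ?thesis using that T unfolding ok_def by blast
qed

section \<open>Monotone paths through the middle levels\<close>

text \<open>\<open>g z\<close> links the edge entering \<open>z\<close> from \<open>z - {j}\<close>, for \<open>j \<in> D z\<close>, to the edge
  from \<open>z\<close> to \<open>insert (g z j) z\<close>.\<close>

locale linked_cube =
  fixes U :: "'a set" and m :: nat and D :: "'a set \<Rightarrow> 'a set" and g :: "'a set \<Rightarrow> 'a \<Rightarrow> 'a"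
  assumes finite_U: "finite U" and card_U: "card U = 2 * m"
    and D_subset: "z \<subseteq> U \<Longrightarrow> D z \<subseteq> z"
    and g_inj: "z \<subseteq> U \<Longrightarrow> inj_on (g z) (D z)"
    and g_image: "z \<subseteq> U \<Longrightarrow> g z ` D z \<subseteq> U - z"
    and D_low: "z \<subseteq> U \<Longrightarrow> card z \<le> m \<Longrightarrow> D z = z"
    and g_high: "z \<subseteq> U \<Longrightarrow> m \<le> card z \<Longrightarrow> g z ` D z = U - z"
begin

text \<open>The pair \<open>(y, j)\<close> stands for the edge from \<open>y\<close> up to \<open>insert j y\<close>. Where
  \<open>linked\<close> fails, \<open>nxt\<close> has an arbitrary second component, but its first component is still
  the upper end of the edge.\<close>

definition upedges :: "('a set \<times> 'a) set" where
  "upedges = (SIGMA y:Pow U. U - y)"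

definition nxt :: "'a set \<times> 'a \<Rightarrow> 'a set \<times> 'a" where
  "nxt = (\<lambda>(y, j). (insert j y, g (insert j y) j))"

definition linked :: "'a set \<times> 'a \<Rightarrow> bool" where
  "linked = (\<lambda>(y, j). j \<in> D (insert j y))"

definition starts :: "('a set \<times> 'a) set" where
  "starts = (SIGMA y:Pow U. U - y - g y ` D y)"

abbreviation run :: "'a set \<times> 'a \<Rightarrow> nat \<Rightarrow> 'a set \<times> 'a" where
  "run p t \<equiv> (nxt ^^ t) p"

abbreviation live :: "'a set \<times> 'a \<Rightarrow> nat \<Rightarrow> bool" where
  "live p t \<equiv> \<forall>u<t. linked (run p u)"

definition len :: "'a set \<times> 'a \<Rightarrow> nat" where
  "len p = (LEAST t. \<not> linked (run p t))"

text \<open>A path has \<open>Suc (len p)\<close> edges. The last application of \<open>nxt\<close>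
  is to an unlinked edge, where only the first component is meaningful.\<close>

definition target :: "'a set \<times> 'a \<Rightarrow> 'a set" where
  "target p = fst (run p (Suc (len p)))"

section \<open>Edge-disjointness, length and end points of the paths\<close>

lemma starts_upedges: "starts \<subseteq> upedges"
  by (auto simp: starts_def upedges_def)

lemma finite_upedges: "finite upedges"
  using finite_U by (auto simp: upedges_def)

lemma fst_nxt: "fst (nxt p) = insert (snd p) (fst p)"
  by (simp add: nxt_def split: prod.split)

text \<open>The common first component is the vertex \<open>z\<close> at which both edges arrive;
  injectivity of \<open>g z\<close> recovers the direction and hence the lower end.\<close>

lemma nxt_inj:
  assumes "p \<in> upedges" "q \<in> upedges" "linked p" "linked q" "nxt p = nxt q"
  shows "p = q"
proof -
  obtain y j y' j' where p: "p = (y, j)" and q: "q = (y', j')" by fastforce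
  define z where "z = insert j y"
  have z: "z = insert j' y'" "g z j = g z j'" using assms(5) by (auto simp: p q nxt_def z_def)
  have "z \<subseteq> U" using assms(1) by (auto simp: p z_def upedges_def)
  moreover have "j \<in> D z" "j' \<in> D z" using assms(3,4) z(1) by (auto simp: p q linked_def z_def)
  ultimately have "j = j'" using z(2) g_inj by (meson inj_onD)
  moreover have "y = z - {j}" "y' = z - {j'}"
    using assms(1,2) z(1) by (auto simp: p q z_def upedges_def)
  ultimately show ?thesis by (simp add: p q)
qed

lemma nxt_upedges:
  assumes "p \<in> upedges" "linked p"
  shows "nxt p \<in> upedges" "nxt p \<notin> starts" "card (fst (nxt p)) = Suc (card (fst p))"
proof -
  obtain y j where p: "p = (y, j)" by fastforce
  have y: "y \<subseteq> U" "j \<in> U" "j \<notin> y" "j \<in> D (insert j y)" using assms by (auto simp: p upedges_def linked_def)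
  then have "g (insert j y) j \<in> U - insert j y" using g_image[of "insert j y"] by blast
  then show "nxt p \<in> upedges" using y by (auto simp: p nxt_def upedges_def)
  show "nxt p \<notin> starts" using y by (auto simp: p nxt_def starts_def)
  show "card (fst (nxt p)) = Suc (card (fst p))"
    using y finite_U by (simp add: p nxt_def finite_subset)
qed

lemma run_upedges:
  assumes "p \<in> upedges" "live p t"
  shows "run p t \<in> upedges \<and> card (fst (run p t)) = card (fst p) + t"
  using assms(2)
proof (induction t)
  case 0
  then show ?case using assms(1) by simp
next
  case (Suc t)
  then have "run p t \<in> upedges" "linked (run p t)" "card (fst (run p t)) = card (fst p) + t"
    by auto
  then show ?case using nxt_upedges[of "run p t"] by simp
qed

text \<open>The paths are edge-disjoint: \<open>nxt_inj\<close> cancels equal last steps until one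
  path is back at its start, and since a start never follows a linked edge, the other path is then
  at its start too.\<close>

lemma run_disjoint:
  assumes "p \<in> starts" "q \<in> starts" "live p t" "live q u" "run p t = run q u"
  shows "p = q \<and> t = u"
  using assms(3-5)
proof (induction t arbitrary: u)
  have no_return: "run r (Suc v) \<notin> starts" if "r \<in> starts" "live r (Suc v)" for r v
    using nxt_upedges(2)[of "run r v"] run_upedges[of r v] starts_upedges that by auto
  {
    case 0
    show ?case
    proof (cases u)
      case (Suc v)
      then show ?thesis using no_return[OF assms(2), of v] 0 assms(1) by auto
    qed (use 0 in auto)
  next
    case (Suc t)
    show ?case
    proof (cases u)
      case 0
      then show ?thesis using no_return[OF assms(1), of t] Suc.prems assms(2) by auto
    next
      case u: (Suc v)
      have "run p t = run q v"
      proof (rule nxt_inj)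
        show "run p t \<in> upedges" "run q v \<in> upedges"
          using run_upedges[of p t] run_upedges[of q v] starts_upedges assms(1,2) Suc.prems u by auto
      qed (use Suc.prems u in auto)
      then show ?thesis using Suc.IH[of v] Suc.prems u by auto
    qed
  }
qed

text \<open>Each linked edge leads one level up and the levels end at \<open>2 * m\<close>, so a
  path cannot go on forever.\<close>

lemma len:
  assumes "p \<in> upedges"
  shows "\<not> linked (run p (len p))" "live p (len p)"
proof -
  have "\<exists>t. \<not> linked (run p t)"
  proof (rule ccontr)
    assume "\<not> ?thesis"
    then have "run p (Suc (2 * m)) \<in> upedges \<and> card (fst (run p (Suc (2 * m)))) = card (fst p) + Suc (2 * m)"
      using run_upedges[OF assms] by blast
    moreover have "card (fst q) \<le> 2 * m" if "q \<in> upedges" for q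
      using that card_mono[OF finite_U, of "fst q"] by (auto simp: upedges_def card_U)
    ultimately show False by fastforce
  qed
  then show "\<not> linked (run p (len p))" unfolding len_def by (rule LeastI_ex)
  show "live p (len p)" unfolding len_def using not_less_Least by blast
qed

lemma run_vertex:
  assumes "p \<in> upedges" "t \<le> Suc (len p)"
  shows "fst (run p t) \<subseteq> U" "card (fst (run p t)) = card (fst p) + t"
proof -
  have "fst (run p t) \<subseteq> U \<and> card (fst (run p t)) = card (fst p) + t"
  proof (cases "t = Suc (len p)")
    \<comment> \<open>The upper end of the last edge lies one step beyond the reach of
      \<open>run_upedges\<close>, because that edge is not linked.\<close>
    case True
    have l: "run p (len p) \<in> upedges" "card (fst (run p (len p))) = card (fst p) + len p"
      using run_upedges[OF assms(1) len(2)[OF assms(1)]] by auto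
    then obtain y j where "run p (len p) = (y, j)" "y \<subseteq> U" "j \<in> U" "j \<notin> y"
      by (auto simp: upedges_def)
    then show ?thesis using True l finite_U by (simp add: fst_nxt finite_subset)
  next
    case False
    then have "live p t" using assms len(2) by (meson le_SucE less_le_trans)
    then have "run p t \<in> upedges \<and> card (fst (run p t)) = card (fst p) + t"
      by (rule run_upedges[OF assms(1)])
    then show ?thesis by (auto simp: upedges_def)
  qed
  then show "fst (run p t) \<subseteq> U" "card (fst (run p t)) = card (fst p) + t" by auto
qed

text \<open>Up to the middle level every incoming edge is linked, so a path can stop only above it.
  The last two facts describe the final edge by the target and an unlinked direction.\<close>

lemma target_high:
  assumes "p \<in> upedges"
  shows "target p \<subseteq> U" "m < card (target p)"
    and "snd (run p (len p)) \<in> target p - D (target p)"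
    and "run p (len p) = (target p - {snd (run p (len p))}, snd (run p (len p)))"
proof -
  obtain y j where yj: "run p (len p) = (y, j)" by fastforce
  then have tgt: "target p = insert j y" by (simp add: target_def fst_nxt)
  show U: "target p \<subseteq> U" unfolding target_def by (rule run_vertex(1)[OF assms order_refl])
  have j: "j \<notin> D (target p)" using len(1)[OF assms] yj tgt by (simp add: linked_def)
  then show "m < card (target p)" using D_low[OF U] tgt by (metis insertI1 not_less)
  show "snd (run p (len p)) \<in> target p - D (target p)" using j tgt yj by simp
  have "j \<notin> y" using run_upedges[OF assms len(2)[OF assms]] yj by (auto simp: upedges_def)
  then show "run p (len p) = (target p - {snd (run p (len p))}, snd (run p (len p)))"
    using yj tgt by simp
qed

section \<open>Counting the paths near the middle level\<close>

definition band :: "nat \<Rightarrow> ('a set \<times> 'a) set" where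
  "band S = {p \<in> starts. m - S \<le> card (fst p) \<and> card (fst p) < m}"

definition good :: "nat \<Rightarrow> ('a set \<times> 'a) set" where
  "good S = {p \<in> band S. card (target p) \<le> m + S}"

lemma finite_good: "finite (good S)"
  using finite_subset[OF starts_upedges finite_upedges] by (auto simp: band_def good_def)

lemma card_low_starts:
  assumes "y \<subseteq> U" "card y \<le> m"
  shows "card (U - y - g y ` D y) = 2 * m - 2 * card y"
proof -
  have "finite y" using assms(1) finite_U finite_subset by blast
  moreover have "g y ` D y \<subseteq> U - y" "card (g y ` D y) = card y"
    using g_image[OF assms(1)] card_image[OF g_inj[OF assms(1)]] D_low[OF assms] by auto
  ultimately show ?thesis
    using assms finite_U card_U by (simp add: card_Diff_subset D_low)
qed

text \<open>From the middle level upwards the links exhaust the outgoing edges, so exactly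
  \<open>2 * m - card z\<close> incoming edges are linked.\<close>

lemma card_high_unlinked:
  assumes "z \<subseteq> U" "m \<le> card z"
  shows "card (z - D z) = 2 * card z - 2 * m"
proof -
  have "finite z" using assms(1) finite_U finite_subset by blast
  moreover have "card (D z) = 2 * m - card z"
    using card_image[OF g_inj[OF assms(1)]] g_high[OF assms] assms(1) finite_U card_U
      \<open>finite z\<close> by (simp add: card_Diff_subset)
  moreover have "card z \<le> 2 * m" using card_mono[OF finite_U assms(1)] card_U by simp
  ultimately show ?thesis
    using D_subset[OF assms(1)] by (simp add: card_Diff_subset finite_subset)
qed

text \<open>A vertex at depth at most \<open>S\<close> has at most \<open>2 * S\<close> outgoing
  edges without a link. This is the first conflict bound for
  \<open>conflict_free_selection\<close>.\<close>

lemma card_good_same_start: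
  assumes "p \<in> good S"
  shows "card {q \<in> good S. fst q = fst p} \<le> 2 * S"
proof -
  let ?y = "fst p"
  have y: "?y \<subseteq> U" "m - S \<le> card ?y" "card ?y < m"
    using assms by (auto simp: good_def band_def starts_def)
  have "card {q \<in> good S. fst q = ?y} \<le> card ({?y} \<times> (U - ?y - g ?y ` D ?y))"
    by (rule card_mono) (use finite_U in \<open>auto simp: good_def band_def starts_def\<close>)
  then show ?thesis using card_low_starts[of ?y] y by (simp add: card_cartesian_product)
qed

text \<open>By \<open>run_disjoint\<close> a path is determined by its last edge, and a vertex at
  height at most \<open>S\<close> has at most \<open>2 * S\<close> unlinked incoming edges.\<close>

lemma card_good_same_target:
  assumes "p \<in> good S"
  shows "card {q \<in> good S. target q = target p} \<le> 2 * S"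
proof -
  let ?z = "target p" and ?last = "\<lambda>q. run q (len q)"
  have good: "q \<in> starts \<and> q \<in> upedges" if "q \<in> good S" for q
    using that starts_upedges by (auto simp: good_def band_def)
  have z: "?z \<subseteq> U" "m < card ?z" "card ?z \<le> m + S"
    using assms target_high good by (auto simp: good_def)
  have "card {q \<in> good S. target q = ?z} = card (?last ` {q \<in> good S. target q = ?z})"
    by (rule card_image[symmetric], rule inj_onI) (use run_disjoint len(2) good in blast)
  also have "\<dots> \<le> card ((\<lambda>j. (?z - {j}, j)) ` (?z - D ?z))"
  proof (rule card_mono)
    show "finite ((\<lambda>j. (?z - {j}, j)) ` (?z - D ?z))"
      using z(1) finite_U by (meson finite_Diff finite_imageI finite_subset)
    show "?last ` {q \<in> good S. target q = ?z} \<subseteq> (\<lambda>j. (?z - {j}, j)) ` (?z - D ?z)"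
    proof (rule image_subsetI)
      fix q assume "q \<in> {q \<in> good S. target q = ?z}"
      then have q: "q \<in> good S" "target q = ?z" by auto
      then show "?last q \<in> (\<lambda>j. (?z - {j}, j)) ` (?z - D ?z)"
        using target_high(3,4)[of q] good[OF q(1)]
        by (intro image_eqI[where x = "snd (?last q)"]) auto
    qed
  qed
  also have "\<dots> \<le> card (?z - D ?z)"
    using z(1) finite_U by (meson card_image_le finite_Diff finite_subset)
  finally show ?thesis using card_high_unlinked[of ?z] z by simp
qed

text \<open>Summed by levels, the starts in the band are the edges entering level \<open>m\<close>
  less those entering level \<open>m - S\<close>.\<close>

lemma card_band:
  assumes "S \<le> m"
  shows "card (band S) + (m - S) * ((2 * m) choose (m - S)) = m * ((2 * m) choose m)"
proof -
  let ?Y = "{y. y \<subseteq> U \<and> card y \<in> {m - S..<m}}"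
  have finY: "finite ?Y" using finite_U by simp
  have "band S = (SIGMA y:?Y. U - y - g y ` D y)"
    by (auto simp: band_def starts_def)
  then have "card (band S) = (\<Sum>y\<in>?Y. card (U - y - g y ` D y))"
    using finY finite_U by (simp add: card_SigmaI)
  also have "\<dots> = (\<Sum>y\<in>?Y. 2 * m - 2 * card y)"
    by (rule sum.cong) (auto simp: card_low_starts)
  also have "\<dots> = (\<Sum>w = m - S..<m. \<Sum>y | y \<in> ?Y \<and> card y = w. 2 * m - 2 * card y)"
    by (rule sum.group[symmetric]) (use finY in auto)
  also have "\<dots> = (\<Sum>w = m - S..<m. (2 * m - 2 * w) * ((2 * m) choose w))"
  proof (rule sum.cong)
    fix w assume w: "w \<in> {m - S..<m}"
    then have "{y. y \<in> ?Y \<and> card y = w} = {y. y \<subseteq> U \<and> card y = w}" by auto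
    then show "(\<Sum>y | y \<in> ?Y \<and> card y = w. 2 * m - 2 * card y) = (2 * m - 2 * w) * ((2 * m) choose w)"
      using n_subsets[OF finite_U, of w] card_U by simp
  qed simp
  finally show ?thesis using sum_binomial_band[OF assms] by simp
qed

text \<open>A path that starts in the band and is not good contains an edge leaving level \<open>m + S\<close>.\<close>

lemma card_band_minus_good:
  assumes "S \<le> m"
  shows "card (band S - good S) \<le> (m - S) * ((2 * m) choose (m - S))"
proof -
  let ?Y = "{y. y \<subseteq> U \<and> card y = m + S}"
  let ?f = "\<lambda>p. run p (m + S - card (fst p))"
  have bad: "p \<in> starts \<and> p \<in> upedges \<and> card (fst p) < m \<and> live p (m + S - card (fst p))"
    if "p \<in> band S - good S" for p
  proof -
    have p: "p \<in> starts" "p \<in> upedges" "card (fst p) < m" "m + S < card (target p)"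
      using that starts_upedges by (auto simp: good_def band_def)
    have "card (target p) = card (fst p) + Suc (len p)"
      unfolding target_def by (rule run_vertex(2)[OF p(2) order_refl])
    then show ?thesis using p len(2)[OF p(2)] by auto
  qed
  have "card (band S - good S) = card (?f ` (band S - good S))"
    by (rule card_image[symmetric], rule inj_onI) (use run_disjoint bad in blast)
  also have "\<dots> \<le> card (SIGMA y:?Y. U - y)"
  proof (rule card_mono)
    show "finite (SIGMA y:?Y. U - y)" using finite_U by simp
    show "?f ` (band S - good S) \<subseteq> (SIGMA y:?Y. U - y)"
    proof (rule image_subsetI)
      fix p assume "p \<in> band S - good S"
      then have "?f p \<in> upedges" "card (fst (?f p)) = m + S"
        using bad[of p] run_upedges[of p "m + S - card (fst p)"] by auto
      then show "?f p \<in> (SIGMA y:?Y. U - y)" by (auto simp: upedges_def)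
    qed
  qed
  also have "\<dots> = (\<Sum>y\<in>?Y. card (U - y))" using finite_U by (simp add: card_SigmaI)
  also have "\<dots> = (\<Sum>y\<in>?Y. m - S)"
    by (rule sum.cong) (use finite_U card_U in \<open>auto simp: card_Diff_subset finite_subset\<close>)
  also have "\<dots> = (m - S) * ((2 * m) choose (m + S))"
    using n_subsets[OF finite_U, of "m + S"] card_U by simp
  also have "(2 * m) choose (m + S) = (2 * m) choose (m - S)"
    using binomial_symmetric[of "m + S" "2 * m"] assms by simp
  finally show ?thesis .
qed

text \<open>The choice of \<open>S\<close> makes the off-centre coefficient at most a quarter of the
  central one. So the band falls short of \<open>m * ((2 * m) choose m)\<close> by at most a
  quarter, and its paths that are not good cost at most another quarter.\<close>

lemma card_good:
  assumes "S \<le> m" "3 * m \<le> S\<^sup>2" "m > 0"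
  shows "m * ((2 * m) choose m) \<le> 2 * card (good S)"
proof -
  let ?a = "(2 * m) choose (m - S)" and ?c = "(2 * m) choose m"
  have "m * (4 * ?a) \<le> ?a * (m + S\<^sup>2)" using mult_left_mono[of "4 * m" "m + S\<^sup>2" ?a] assms(2) by simp
  also have "\<dots> \<le> m * ?c" by (rule binomial_off_centre_bound[OF assms(1)])
  finally have "4 * ?a \<le> ?c" using assms(3) by simp
  then have "(m - S) * (4 * ?a) \<le> m * ?c" by (intro mult_mono) auto
  moreover have "card (band S) \<le> card (good S) + card (band S - good S)"
    using finite_good by (simp add: card_Diff_subset good_def)
  ultimately show ?thesis using card_band[OF assms(1)] card_band_minus_good[OF assms(1)] by simp
qed

end

text \<open>The conditions concern each vertex separately. Any bijection between
  \<open>min (card z) (card (U - z))\<close> incoming and as many outgoing directions will do, as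
  the minimum takes up all of \<open>z\<close> below the middle and all of \<open>U - z\<close>
  above it.\<close>

lemma linked_cube_exists:
  assumes "finite U" "card U = 2 * m"
  obtains D g where "linked_cube U m D g"
proof -
  have "\<exists>D g. D \<subseteq> z \<and> inj_on g D \<and> g ` D \<subseteq> U - z \<and> (card z \<le> m \<longrightarrow> D = z) \<and> (m \<le> card z \<longrightarrow> g ` D = U - z)"
    if z: "z \<subseteq> U" for z
  proof -
    have fin: "finite z" "finite (U - z)" using z assms(1) finite_subset by auto
    have c: "card (U - z) = 2 * m - card z" "card z \<le> 2 * m"
      using z assms fin card_mono[OF assms(1) z] by (auto simp: card_Diff_subset)
    define r where "r = min (card z) (card (U - z))"
    obtain D where D: "D \<subseteq> z" "card D = r" "finite D" by (metis obtain_subset_with_card_n min.cobounded1 r_def)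
    obtain E where E: "E \<subseteq> U - z" "card E = r" "finite E" by (metis obtain_subset_with_card_n min.cobounded2 r_def)
    obtain g where "bij_betw g D E" using finite_same_card_bij D E by metis
    moreover have "D = z" if "card z \<le> m" using that c D fin by (intro card_subset_eq) (auto simp: r_def)
    moreover have "E = U - z" if "m \<le> card z" using that c E fin by (intro card_subset_eq) (auto simp: r_def)
    ultimately show ?thesis using D E by (intro exI[of _ D] exI[of _ g]) (auto simp: bij_betw_def)
  qed
  then obtain D g where "\<And>z. z \<subseteq> U \<Longrightarrow> D z \<subseteq> z \<and> inj_on (g z) (D z) \<and> g z ` D z \<subseteq> U - z \<and>
      (card z \<le> m \<longrightarrow> D z = z) \<and> (m \<le> card z \<longrightarrow> g z ` D z = U - z)"
    by metis
  then have "linked_cube U m D g" using assms by unfold_locales auto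
  then show ?thesis by (rule that)
qed

section \<open>Cycles\<close>

definition vx :: "nat \<Rightarrow> nat set \<Rightarrow> vertex" where
  "vx d A = (\<lambda>j\<in>{1..d}. if j \<in> A then 1 else 0)"

lemma vx_vertex: "vx d A \<in> cube_vertices d"
  unfolding vx_def cube_vertices_def by (rule restrict_PiE_iff[THEN iffD2]) simp

lemma vx_inj:
  assumes "vx d A = vx d B" "A \<subseteq> {1..d}" "B \<subseteq> {1..d}"
  shows "A = B"
proof -
  have "j \<in> A \<longleftrightarrow> j \<in> B" if "j \<in> {1..d}" for j
  proof -
    have "(if j \<in> A then 1 else 0 :: nat) = (if j \<in> B then 1 else 0)"
      using fun_cong[OF assms(1), of j] that by (simp add: vx_def)
    then show ?thesis by (simp split: if_splits)
  qed
  then show ?thesis using assms(2,3) by blast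
qed

lemma upper_weight_vx: "upper_weight k d (vx d A) = card (A \<inter> {Suc k..d})"
  unfolding upper_weight_def by (rule arg_cong[of _ _ card]) (auto simp: vx_def)

lemma vx_edge:
  assumes "j \<in> {1..d}" "j \<notin> A"
  shows "{vx d A, vx d (insert j A)} \<in> cube_edges d"
    and "Delta k d {vx d A, vx d (insert j A)} =
      (if j \<le> k \<and> real (card (A \<inter> {Suc k..d})) \<le> (real d - real k) / 2 then 1 else 0)"
proof -
  have j: "vx d A j \<noteq> vx d (insert j A) j" using assms by (simp add: vx_def)
  have ex: "\<exists>!i. i \<in> {1..d} \<and> vx d A i \<noteq> vx d (insert j A) i"
  proof (rule ex1I[of _ j])
    show "i = j" if "i \<in> {1..d} \<and> vx d A i \<noteq> vx d (insert j A) i" for i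
      using that by (auto simp: vx_def split: if_splits)
  qed (use j assms in auto)
  show e: "{vx d A, vx d (insert j A)} \<in> cube_edges d"
    unfolding cube_edges_def using ex vx_vertex by blast
  show "Delta k d {vx d A, vx d (insert j A)} =
      (if j \<le> k \<and> real (card (A \<inter> {Suc k..d})) \<le> (real d - real k) / 2 then 1 else 0)"
    using Delta_edge[OF e] edge_dir_eq(1)[OF vx_vertex vx_vertex ex j] upper_weight_vx by simp
qed

text \<open>If the ends matched crosswise, each of \<open>A\<close> and \<open>B\<close> would
  strictly contain the other. Thus lower end and direction identify an edge.\<close>

lemma vx_edge_inj:
  assumes "{vx d A, vx d (insert i A)} = {vx d B, vx d (insert j B)}"
    and "insert i A \<subseteq> {1..d}" "insert j B \<subseteq> {1..d}" "i \<notin> A" "j \<notin> B"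
  shows "A = B \<and> i = j"
proof -
  have "A = B \<and> insert i A = insert j B \<or> A = insert j B \<and> insert i A = B"
  proof -
    have "A \<subseteq> {1..d}" "B \<subseteq> {1..d}" using assms(2,3) by auto
    then show ?thesis
      using assms(1) vx_inj[of d] assms(2,3) unfolding doubleton_eq_iff by metis
  qed
  then show ?thesis using assms(4,5) by blast
qed

text \<open>Every edge is reached from both of its ends; the factor of two lost here only affects
  the final constant.\<close>

lemma card_cube_edges_le: "card (cube_edges d) \<le> d * 2 ^ d"
proof -
  have fin: "finite (cube_vertices d)" by (simp add: cube_vertices_def finite_PiE)
  have "card (cube_vertices d) = 2 ^ d" by (simp add: cube_vertices_def card_PiE numeral_2_eq_2)
  define flip where "flip = (\<lambda>(j, u :: vertex). {u, u(j := 1 - u j)})"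
  have "cube_edges d \<subseteq> flip ` ({1..d} \<times> cube_vertices d)"
  proof
    fix e assume "e \<in> cube_edges d"
    then obtain u v where e: "e = {u, v}" and u: "u \<in> cube_vertices d" and v: "v \<in> cube_vertices d"
      and "\<exists>!j. j \<in> {1..d} \<and> u j \<noteq> v j"
      unfolding cube_edges_def by blast
    then obtain j where j: "j \<in> {1..d}" "u j \<noteq> v j" "\<And>i. i \<in> {1..d} \<Longrightarrow> u i \<noteq> v i \<Longrightarrow> i = j" by blast
    have "v = u(j := 1 - u j)"
    proof
      fix i
      have "u i = v i" if "i \<notin> {1..d}" using u v that unfolding cube_vertices_def by (metis PiE_arb)
      then have "u i = v i" if "i \<noteq> j" using j(3) that by blast
      moreover have "u j \<in> {0, 1}" "v j \<in> {0, 1}"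
        using u v j(1) unfolding cube_vertices_def by (blast dest: PiE_mem)+
      ultimately show "v i = (u(j := 1 - u j)) i" using j(2) by (cases "i = j") auto
    qed
    then have "e = flip (j, u)" using e by (simp add: flip_def)
    then show "e \<in> flip ` ({1..d} \<times> cube_vertices d)" using u j(1) by blast
  qed
  then have "card (cube_edges d) \<le> card ({1..d} \<times> cube_vertices d)"
    using fin by (intro surj_card_le) auto
  then show ?thesis using \<open>card (cube_vertices d) = 2 ^ d\<close> by (simp add: card_cartesian_product)
qed

section \<open>Ladder-shaped cycles\<close>

definition ladder :: "(nat \<Rightarrow> 'b) \<Rightarrow> (nat \<Rightarrow> 'b) \<Rightarrow> nat \<Rightarrow> 'b list" where
  "ladder f h L = map f [0..<L] @ rev (map h [0..<L])"

text \<open>The list runs up \<open>f\<close> and back down \<open>h\<close>, so it crosses between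
  the rails only at the turn, index \<open>L - 1\<close>, and at the closing edge, index
  \<open>0\<close>.\<close>

lemma cycle_edges_ladder:
  assumes "0 < L"
  shows "cycle_edges (ladder f h L) = {{f t, f (Suc t)} | t. Suc t < L} \<union>
    {{h t, h (Suc t)} | t. Suc t < L} \<union> {{f 0, h 0}, {f (L - 1), h (L - 1)}}"
    (is "_ = ?R")
proof -
  have len: "length (ladder f h L) = 2 * L" by (simp add: ladder_def)
  have lo: "ladder f h L ! t = f t" if "t < L" for t
    using that by (simp add: ladder_def nth_append)
  have hi: "ladder f h L ! t = h (2 * L - 1 - t)" if "L \<le> t" "t < 2 * L" for t
  proof -
    have "2 * L - Suc t < L" "L - Suc (t - L) = 2 * L - Suc t" using that by auto
    then show ?thesis using that by (simp add: ladder_def nth_append rev_nth)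
  qed
  have "e \<in> ?R" if "e \<in> cycle_edges (ladder f h L)" for e
  proof -
    have "\<exists>j. e = {ladder f h L ! j, ladder f h L ! (Suc j mod (2 * L))} \<and> j < 2 * L"
      using that unfolding cycle_edges_def len by (rule CollectD)
    then obtain j where e: "e = {ladder f h L ! j, ladder f h L ! (Suc j mod (2 * L))}" and j: "j < 2 * L"
      by (elim exE conjE)
    consider "Suc j < L" | "Suc j = L" | "L \<le> j" "Suc j < 2 * L" | "Suc j = 2 * L" using j by linarith
    then show ?thesis
    proof cases
      case 1
      then show ?thesis using e lo by auto
    next
      case 2
      then have "Suc j mod (2 * L) = L" "j = L - 1" "2 * L - 1 - L = L - 1" using assms by auto
      then show ?thesis using e lo[of j] hi[of L] 2 by simp
    next
      case 3
      then have "e = {h (Suc (2 * L - 1 - Suc j)), h (2 * L - 1 - Suc j)}"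
        using e hi[of j] hi[of "Suc j"] by (simp add: Suc_diff_Suc)
      moreover have "Suc (2 * L - 1 - Suc j) < L" using 3 by linarith
      ultimately show ?thesis by blast
    next
      case 4
      then show ?thesis using e lo[of 0] hi[of j] assms by (auto simp: insert_commute)
    qed
  qed
  moreover have "e \<in> cycle_edges (ladder f h L)" if "e \<in> ?R" for e
  proof -
    have I: "{ladder f h L ! j, ladder f h L ! (Suc j mod (2 * L))} \<in> cycle_edges (ladder f h L)"
      if "j < 2 * L" for j
      using that unfolding cycle_edges_def len by blast
    consider t where "Suc t < L" "e = {f t, f (Suc t)}" | t where "Suc t < L" "e = {h t, h (Suc t)}"
      | "e = {f 0, h 0}" | "e = {f (L - 1), h (L - 1)}" using \<open>e \<in> ?R\<close> by blast
    then show ?thesis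
    proof cases
      case 1
      then show ?thesis using I[of t] lo[of t] lo[of "Suc t"] by simp
    next
      case 2
      \<comment> \<open>Position \<open>2 * L - 2 - t\<close> of the list holds
        \<open>h (Suc t)\<close>, and the next position holds \<open>h t\<close>.\<close>
      have "2 * L - 1 - (2 * L - 2 - t) = Suc t" "2 * L - 1 - Suc (2 * L - 2 - t) = t"
        "Suc (2 * L - 2 - t) < 2 * L" "L \<le> 2 * L - 2 - t" using 2 by linarith+
      then show ?thesis using I[of "2 * L - 2 - t"] hi[of "2 * L - 2 - t"] hi[of "Suc (2 * L - 2 - t)"] 2
        by (simp add: insert_commute)
    next
      case 3
      then show ?thesis using I[of "2 * L - 1"] lo[of 0] hi[of "2 * L - 1"] assms
        by (simp add: insert_commute)
    next
      case 4
      have "Suc (L - 1) mod (2 * L) = L" using assms by simp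
      then show ?thesis using I[of "L - 1"] lo[of "L - 1"] hi[of L] assms 4 by simp
    qed
  qed
  ultimately show ?thesis by blast
qed

lemma distinct_ladder:
  assumes "inj_on f {..<L}" "inj_on h {..<L}" "f ` {..<L} \<inter> h ` {..<L} = {}"
  shows "distinct (ladder f h L)"
  using assms by (simp add: ladder_def distinct_map atLeast0LessThan)

text \<open>A satisfying assignment is constant on each rail, so the two rungs compare the same two
  values, one demanding equality and the other inequality.\<close>

lemma inconsistent_ladder:
  assumes "0 < L"
    and rails: "\<And>t. Suc t < L \<Longrightarrow> I {f t, f (Suc t)} = 0" "\<And>t. Suc t < L \<Longrightarrow> I {h t, h (Suc t)} = 0"
    and rungs: "I {f 0, h 0} = 1" "I {f (L - 1), h (L - 1)} = 0"
  shows "inconsistent d I (ladder f h L)"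
  unfolding inconsistent_def
proof clarify
  fix \<sigma> assume sat: "\<forall>e \<in> cycle_edges (ladder f h L). satisfies I \<sigma> e"
  have const: "\<sigma> (f t) = \<sigma> (f 0) \<and> \<sigma> (h t) = \<sigma> (h 0)" if "t < L" for t
    using that
  proof (induction t)
    case (Suc t)
    then have "satisfies I \<sigma> {f t, f (Suc t)}" "satisfies I \<sigma> {h t, h (Suc t)}"
      using sat cycle_edges_ladder[OF assms(1), of f h] by blast+
    then have "\<sigma> (f t) = \<sigma> (f (Suc t))" "\<sigma> (h t) = \<sigma> (h (Suc t))"
      using rails[of t] Suc.prems by (auto simp: satisfies_def)
    then show ?case using Suc by simp
  qed simp
  have "\<sigma> (f (L - 1)) = \<sigma> (f 0)" "\<sigma> (h (L - 1)) = \<sigma> (h 0)"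
    using const[of "L - 1"] assms(1) by auto
  moreover have "satisfies I \<sigma> {f 0, h 0}" "satisfies I \<sigma> {f (L - 1), h (L - 1)}"
    using sat cycle_edges_ladder[OF assms(1), of f h] by blast+
  then have "\<sigma> (f 0) \<noteq> \<sigma> (h 0)" "\<sigma> (f (L - 1)) = \<sigma> (h (L - 1))"
    using rungs by (auto simp: satisfies_def)
  ultimately show False by simp
qed

section \<open>Ladders over the monotone paths\<close>

text \<open>Here \<open>m\<close> is half of \<open>d - k\<close>, rounded down; for odd
  \<open>d - k\<close> coordinate \<open>d\<close> stays \<open>0\<close> on all the cycles.\<close>

locale cube_ladders = linked_cube "{Suc k..k+2*m}" m D g for k m D g +
  fixes d :: nat
  assumes d_lower: "k + 2 * m \<le> d" and d_upper: "d \<le> k + 2 * m + 1"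
begin

abbreviation rail :: "nat set \<Rightarrow> nat set \<times> nat \<Rightarrow> nat \<Rightarrow> vertex" where
  "rail x p t \<equiv> vx d (x \<union> fst (run p t))"

text \<open>With \<open>Suc (len p)\<close> edges on the path, each rail has
  \<open>Suc (Suc (len p))\<close> vertices.\<close>

definition cyc :: "(nat set \<times> nat) \<times> nat \<Rightarrow> nat set \<Rightarrow> vertex list" where
  "cyc = (\<lambda>(p, i) x. ladder (rail x p) (rail (insert i x) p) (Suc (Suc (len p))))"

lemma rail_Suc: "rail x p (Suc t) = vx d (insert (snd (run p t)) (x \<union> fst (run p t)))"
  by (simp add: fst_nxt)

lemma rail_edge:
  assumes "p \<in> upedges" "t \<le> len p" "x \<subseteq> {1..k}"
  shows "{rail x p t, rail x p (Suc t)} \<in> cube_edges d"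
    and "Delta k d {rail x p t, rail x p (Suc t)} = 0"
proof -
  have "run p t \<in> upedges" using run_upedges[of p t] len(2)[of p] assms by auto
  then have "snd (run p t) \<in> {Suc k..k+2*m}" "snd (run p t) \<notin> fst (run p t)"
    by (auto simp: upedges_def)
  then have "snd (run p t) \<in> {1..d}" "snd (run p t) \<notin> x \<union> fst (run p t)" "k < snd (run p t)"
    using assms(3) d_lower by auto
  then show "{rail x p t, rail x p (Suc t)} \<in> cube_edges d"
    "Delta k d {rail x p t, rail x p (Suc t)} = 0"
    using vx_edge(1)[of "snd (run p t)" d "x \<union> fst (run p t)"]
      vx_edge(2)[of "snd (run p t)" d "x \<union> fst (run p t)" k] unfolding rail_Suc by auto
qed

lemma rung_edge:
  assumes "y \<subseteq> {Suc k..k+2*m}" "x \<subseteq> {1..k} - {i}" "i \<in> {1..k}"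
  shows "{vx d (x \<union> y), vx d (insert i x \<union> y)} \<in> cube_edges d"
    and "Delta k d {vx d (x \<union> y), vx d (insert i x \<union> y)} = (if card y \<le> m then 1 else 0)"
proof -
  have i: "i \<in> {1..d}" "i \<notin> x \<union> y" "i \<le> k" "insert i x \<union> y = insert i (x \<union> y)"
    and y: "(x \<union> y) \<inter> {Suc k..d} = y" using assms d_lower by auto
  \<comment> \<open>For odd \<open>d - k\<close> the threshold is \<open>m + 1/2\<close>, which
    admits the same integers as \<open>m\<close>.\<close>
  have "real (card y) \<le> (real d - real k) / 2 \<longleftrightarrow> card y \<le> m"
  proof -
    have "real (card y) \<le> (real d - real k) / 2 \<longleftrightarrow> real (2 * card y + k) \<le> real d" by auto
    also have "\<dots> \<longleftrightarrow> 2 * card y + k \<le> d" by (rule of_nat_le_iff)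
    finally show ?thesis using d_lower d_upper by linarith
  qed
  then show "{vx d (x \<union> y), vx d (insert i x \<union> y)} \<in> cube_edges d"
    and "Delta k d {vx d (x \<union> y), vx d (insert i x \<union> y)} = (if card y \<le> m then 1 else 0)"
    using vx_edge(1)[OF i(1,2)] vx_edge(2)[OF i(1,2), of k] i(3) unfolding i(4) y by auto
qed

text \<open>The rails change only coordinates above \<open>k\<close> and consist of equality edges.
  The path starts no higher than the middle and ends above it, so the first rung is an inequality
  edge and the last one an equality edge.\<close>

lemma cyc_inconsistent_cycle:
  assumes p: "p \<in> upedges" "card (fst p) \<le> m" and x: "x \<subseteq> {1..k} - {i}" "i \<in> {1..k}"
  shows "is_cycle d (cyc (p, i) x)" "inconsistent d (Delta k d) (cyc (p, i) x)"
proof -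
  let ?L = "Suc (Suc (len p))"
  have X: "x \<subseteq> {1..k}" "insert i x \<subseteq> {1..k}" "i \<notin> x" using x by auto
  have V: "fst (run p t) \<subseteq> {Suc k..k+2*m}" if "t < ?L" for t
    using run_vertex(1)[OF p(1), of t] that by simp
  have run_inj: "inj_on (\<lambda>t. fst (run p t)) {..<?L}"
    by (rule inj_onI) (metis add_left_cancel lessThan_iff less_Suc_eq_le p(1) run_vertex(2))
  have eq: "X = X' \<and> fst (run p t) = fst (run p u)"
    if "rail X p t = rail X' p u" "X \<subseteq> {1..k}" "X' \<subseteq> {1..k}" "t < ?L" "u < ?L" for X X' t u
  proof -
    have "X \<union> fst (run p t) = X' \<union> fst (run p u)"
      by (rule vx_inj[OF that(1)]) (use that V[of t] V[of u] d_lower in force)+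
    moreover have "(X \<union> fst (run p t)) \<inter> {1..k} = X" "(X' \<union> fst (run p u)) \<inter> {1..k} = X'"
      "(X \<union> fst (run p t)) \<inter> {Suc k..k+2*m} = fst (run p t)"
      "(X' \<union> fst (run p u)) \<inter> {Suc k..k+2*m} = fst (run p u)"
      using that V[of t] V[of u] by fastforce+
    ultimately show ?thesis by metis
  qed
  have edges: "{rail x p t, rail x p (Suc t)} \<in> cube_edges d"
    "Delta k d {rail x p t, rail x p (Suc t)} = 0"
    "{rail (insert i x) p t, rail (insert i x) p (Suc t)} \<in> cube_edges d"
    "Delta k d {rail (insert i x) p t, rail (insert i x) p (Suc t)} = 0" if "Suc t < ?L" for t
    using rail_edge[OF p(1) _ X(1), of t] rail_edge[OF p(1) _ X(2), of t] that by auto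
  have first: "{rail x p 0, rail (insert i x) p 0} \<in> cube_edges d"
    "Delta k d {rail x p 0, rail (insert i x) p 0} = 1"
    using rung_edge[OF V[of 0] x] p(2) by auto
  have last: "{rail x p (?L - 1), rail (insert i x) p (?L - 1)} \<in> cube_edges d"
    "Delta k d {rail x p (?L - 1), rail (insert i x) p (?L - 1)} = 0"
    using rung_edge[OF V[of "?L - 1"] x] target_high(2)[OF p(1)] by (auto simp: target_def)
  have "distinct (cyc (p, i) x)"
    unfolding cyc_def split
  proof (rule distinct_ladder)
    have "inj_on (rail X p) {..<?L}" if "X \<subseteq> {1..k}" for X
    proof (rule inj_onI)
      fix t u assume tu: "t \<in> {..<?L}" "u \<in> {..<?L}" "rail X p t = rail X p u"
      then have "fst (run p t) = fst (run p u)" using eq[OF tu(3) that that] by blast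
      then show "t = u" using inj_onD[OF run_inj] tu by blast
    qed
    then show "inj_on (rail x p) {..<?L}" "inj_on (rail (insert i x) p) {..<?L}"
      using X by blast+
    show "rail x p ` {..<?L} \<inter> rail (insert i x) p ` {..<?L} = {}"
    proof (rule equals0I)
      fix b assume "b \<in> rail x p ` {..<?L} \<inter> rail (insert i x) p ` {..<?L}"
      then obtain t u where "rail x p t = rail (insert i x) p u" "t < ?L" "u < ?L" by auto
      from eq[OF this(1) X(1,2) this(2,3)] show False using X(3) by blast
    qed
  qed
  moreover have "set (cyc (p, i) x) \<subseteq> cube_vertices d"
    by (auto simp: cyc_def ladder_def vx_vertex)
  moreover have "cycle_edges (cyc (p, i) x) \<subseteq> cube_edges d"
    unfolding cyc_def split cycle_edges_ladder[OF zero_less_Suc]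
    using edges(1,3) first(1) last(1) by blast
  ultimately show "is_cycle d (cyc (p, i) x)"
    by (simp add: is_cycle_def cyc_def ladder_def)
  show "inconsistent d (Delta k d) (cyc (p, i) x)"
    unfolding cyc_def split
    by (rule inconsistent_ladder) (use edges first last in auto)
qed

text \<open>All edges are brought to the form of a lower end and a direction, ready for
  \<open>vx_edge_inj\<close>.\<close>

lemma cyc_edgeE:
  assumes "e \<in> cycle_edges (cyc (p, i) x)"
  obtains (rail) t X where "t \<le> len p" "X \<in> {x, insert i x}"
      "e = {vx d (X \<union> fst (run p t)), vx d (insert (snd (run p t)) (X \<union> fst (run p t)))}"
    | (rung) y where "y \<in> {fst p, target p}" "e = {vx d (x \<union> y), vx d (insert i (x \<union> y))}"
proof -
  consider t where "t \<le> len p" "e = {rail x p t, rail x p (Suc t)}"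
    | t where "t \<le> len p" "e = {rail (insert i x) p t, rail (insert i x) p (Suc t)}"
    | "e = {rail x p 0, rail (insert i x) p 0}"
    | "e = {rail x p (Suc (len p)), rail (insert i x) p (Suc (len p))}"
    using assms
    unfolding cyc_def split cycle_edges_ladder[OF zero_less_Suc] Suc_less_eq less_Suc_eq_le diff_Suc_1
    by blast
  then show ?thesis
  proof cases
    case 1
    then show ?thesis using that(1)[of _ x] unfolding rail_Suc by blast
  next
    case 2
    then show ?thesis using that(1)[of _ "insert i x"] unfolding rail_Suc by blast
  next
    case 3
    then show ?thesis using that(2)[of "fst p"] by simp
  next
    case 4
    then show ?thesis using that(2)[of "target p"] unfolding target_def by simp
  qed
qed

text \<open>Rail and rung edges differ in direction, above \<open>k\<close> or not. A common rail
  edge forces the same path by \<open>run_disjoint\<close>, and a path is selected with one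
  direction only. A common rung has the same direction and the same start or target, which the
  selection allows for one path only.\<close>

lemma cyc_edge_disjoint:
  assumes T: "inj_on fst T" "inj_on (\<lambda>(p, i). (fst p, i)) T" "inj_on (\<lambda>(p, i). (target p, i)) T"
    and p: "(p, i) \<in> T" "p \<in> starts" "card (fst p) \<le> m" "i \<in> {1..k}" "x \<subseteq> {1..k} - {i}"
    and q: "(q, j) \<in> T" "q \<in> starts" "card (fst q) \<le> m" "j \<in> {1..k}" "w \<subseteq> {1..k} - {j}"
    and e: "e \<in> cycle_edges (cyc (p, i) x)" "e \<in> cycle_edges (cyc (q, j) w)"
  shows "p = q \<and> i = j \<and> x = w"
proof -
  have up: "p \<in> upedges" "q \<in> upedges" using p(2) q(2) starts_upedges by auto
  have split_eq: "X = X' \<and> y = y'" if "X \<union> y = X' \<union> y'" "X \<subseteq> {1..k}" "X' \<subseteq> {1..k}"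
    "y \<subseteq> {Suc k..k+2*m}" "y' \<subseteq> {Suc k..k+2*m}" for X X' y y' :: "nat set"
  proof -
    have "(X \<union> y) \<inter> {1..k} = X" "(X' \<union> y') \<inter> {1..k} = X'"
      "(X \<union> y) \<inter> {Suc k..k+2*m} = y" "(X' \<union> y') \<inter> {Suc k..k+2*m} = y'" using that by fastforce+
    then show ?thesis using that(1) by metis
  qed
  have run: "fst (run r t) \<subseteq> {Suc k..k+2*m} \<and> snd (run r t) \<in> {Suc k..k+2*m} \<and>
      snd (run r t) \<notin> fst (run r t) \<and> live r t" if "r \<in> upedges" "t \<le> len r" for r t
  proof -
    have "live r t" using len(2)[OF that(1)] that(2) by auto
    then show ?thesis using run_upedges[OF that(1), of t] by (auto simp: upedges_def)
  qed
  have ends: "y \<subseteq> {Suc k..k+2*m}" if "y \<in> {fst r, target r}" "r \<in> upedges" for r y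
    using that target_high(1)[of r] by (auto simp: upedges_def)
  show ?thesis
    using e(1)
  proof (cases rule: cyc_edgeE)
    case rl: (rail t X)
    have X: "X \<subseteq> {1..k}" using rl p by auto
    have r: "fst (run p t) \<subseteq> {Suc k..k+2*m}" "snd (run p t) \<in> {Suc k..k+2*m}"
      "snd (run p t) \<notin> fst (run p t)" "live p t" using run[OF up(1) rl(1)] by auto
    show ?thesis
      using e(2)
    proof (cases rule: cyc_edgeE)
      case rl': (rail t' X')
      have X': "X' \<subseteq> {1..k}" using rl' q by auto
      have r': "fst (run q t') \<subseteq> {Suc k..k+2*m}" "snd (run q t') \<in> {Suc k..k+2*m}"
        "snd (run q t') \<notin> fst (run q t')" "live q t'" using run[OF up(2) rl'(1)] by auto
      have same: "X \<union> fst (run p t) = X' \<union> fst (run q t') \<and> snd (run p t) = snd (run q t')"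
        by (rule vx_edge_inj[of d]) (use rl(3) rl'(3) X X' r r' d_lower in \<open>auto\<close>)
      have "X = X' \<and> fst (run p t) = fst (run q t')"
        by (rule split_eq[OF conjunct1[OF same] X X' r(1) r'(1)])
      then have "X = X'" "run p t = run q t'" using same by (auto simp: prod_eq_iff)
      then have "p = q" using run_disjoint p(2) q(2) r(4) r'(4) by blast
      moreover have "i = j" using inj_onD[OF T(1) _ p(1) q(1)] calculation by simp
      \<comment> \<open>The two rails of one cycle differ just in \<open>i\<close>, so removing
        \<open>i\<close> gives the index \<open>x\<close> from either of them.\<close>
      moreover have "X - {i} = x" "X' - {j} = w" using rl(2) rl'(2) p(5) q(5) by auto
      ultimately show ?thesis using \<open>X = X'\<close> by auto
    next
      case rg: (rung y)
      have y: "y \<subseteq> {Suc k..k+2*m}" using ends rg(1) up by blast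
      have "X \<union> fst (run p t) = w \<union> y \<and> snd (run p t) = j"
        by (rule vx_edge_inj[of d]) (use rl(3) rg(2) X q y r d_lower in \<open>auto\<close>)
      then show ?thesis using r(2) q(4) by auto
    qed
  next
    case rg: (rung y)
    have y: "y \<subseteq> {Suc k..k+2*m}" using ends rg(1) up by blast
    show ?thesis
      using e(2)
    proof (cases rule: cyc_edgeE)
      case rl: (rail t X)
      have X: "X \<subseteq> {1..k}" using rl q by auto
      have r: "fst (run q t) \<subseteq> {Suc k..k+2*m}" "snd (run q t) \<in> {Suc k..k+2*m}"
        "snd (run q t) \<notin> fst (run q t)" using run[OF up(2) rl(1)] by auto
      have "X \<union> fst (run q t) = x \<union> y \<and> snd (run q t) = i"
        by (rule vx_edge_inj[of d]) (use rl(3) rg(2) X p y r d_lower in \<open>auto\<close>)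
      then show ?thesis using r(2) p(4) by auto
    next
      case rg': (rung y')
      have y': "y' \<subseteq> {Suc k..k+2*m}" using ends rg'(1) up by blast
      have same: "x \<union> y = w \<union> y' \<and> i = j"
        by (rule vx_edge_inj[of d]) (use rg(2) rg'(2) p q y y' d_lower in \<open>auto\<close>)
      have xy: "x = w \<and> y = y'"
        by (rule split_eq[OF conjunct1[OF same] _ _ y y']) (use p(5) q(5) in auto)
      have "m < card (target p)" "m < card (target q)" using target_high(2) up by auto
      \<comment> \<open>A start is never above level \<open>m\<close> and a target always is, so a
        start cannot coincide with a target.\<close>
      then have "fst p = fst q \<or> target p = target q" using xy rg(1) rg'(1) p(3) q(3)
        by (metis insertE singletonD not_less)
      then have "p = q"
        using inj_onD[OF T(2) _ p(1) q(1)] inj_onD[OF T(3) _ p(1) q(1)] same by auto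
      then show ?thesis using same xy by blast
    qed
  qed
qed

text \<open>Each selected pair \<open>(p, i)\<close> is used in all \<open>2 ^ (k - 1)\<close>
  positions \<open>x\<close> of the lower coordinates other than \<open>i\<close>.\<close>

lemma edge_disjoint_cycles:
  assumes T: "T \<subseteq> good S \<times> {1..k}" "inj_on fst T"
    "inj_on (\<lambda>(p, i). (fst p, i)) T" "inj_on (\<lambda>(p, i). (target p, i)) T"
  obtains C where "finite C" "\<And>c. c \<in> C \<Longrightarrow> is_cycle d c \<and> inconsistent d (Delta k d) c"
    "pairwise (\<lambda>c c'. cycle_edges c \<inter> cycle_edges c' = {}) C" "card C = card T * 2 ^ (k - 1)"
proof -
  define J where "J = (SIGMA s:T. Pow ({1..k} - {snd s}))"
  define C where "C = (\<lambda>(s, x). cyc s x) ` J"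
  have J: "(p, i) \<in> T \<and> p \<in> starts \<and> card (fst p) \<le> m \<and> i \<in> {1..k} \<and> x \<subseteq> {1..k} - {i}"
    if "((p, i), x) \<in> J" for p i x
    using that T(1) by (auto simp: J_def good_def band_def)
  have disj: "((p, i), x) = ((q, j), w)"
    if "((p, i), x) \<in> J" "((q, j), w) \<in> J" "e \<in> cycle_edges (cyc (p, i) x)"
      "e \<in> cycle_edges (cyc (q, j) w)" for p i x q j w e
    using cyc_edge_disjoint[OF T(2-4), of p i x q j w e] J[OF that(1)] J[OF that(2)] that(3,4) by blast
  have finT: "finite T" using T(1) finite_good by (meson finite_SigmaI finite_atLeastAtMost finite_subset)
  then have finC: "finite C" by (simp add: C_def J_def)
  have C_cyc: "\<exists>p i x. c = cyc (p, i) x \<and> ((p, i), x) \<in> J" if "c \<in> C" for c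
  proof -
    obtain s where "s \<in> J" "c = (case s of (s, x) \<Rightarrow> cyc s x)" using \<open>c \<in> C\<close> unfolding C_def by blast
    then show ?thesis by (metis case_prod_conv surj_pair)
  qed
  have "is_cycle d c \<and> inconsistent d (Delta k d) c" if "c \<in> C" for c
  proof -
    obtain p i x where c: "c = cyc (p, i) x" "((p, i), x) \<in> J" using C_cyc[OF \<open>c \<in> C\<close>] by blast
    then have "p \<in> upedges" "card (fst p) \<le> m" "x \<subseteq> {1..k} - {i}" "i \<in> {1..k}"
      using J[OF c(2)] starts_upedges by blast+
    then show ?thesis unfolding c(1) using cyc_inconsistent_cycle by blast
  qed
  moreover have "pairwise (\<lambda>c c'. cycle_edges c \<inter> cycle_edges c' = {}) C"
  proof (rule pairwiseI, rule ccontr)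
    fix c c' assume cc: "c \<in> C" "c' \<in> C" "c \<noteq> c'" "cycle_edges c \<inter> cycle_edges c' \<noteq> {}"
    obtain p i x where c: "c = cyc (p, i) x" "((p, i), x) \<in> J" using C_cyc[OF cc(1)] by blast
    obtain q j w where c': "c' = cyc (q, j) w" "((q, j), w) \<in> J" using C_cyc[OF cc(2)] by blast
    obtain e where "e \<in> cycle_edges c" "e \<in> cycle_edges c'" using cc(4) by blast
    then have "((p, i), x) = ((q, j), w)" unfolding c(1) c'(1) by (rule disj[OF c(2) c'(2)])
    then show False using cc(3) c(1) c'(1) by simp
  qed
  moreover have "card C = card T * 2 ^ (k - 1)"
  proof -
    have "inj_on (\<lambda>(s, x). cyc s x) J"
    proof (rule inj_onI)
      fix s s'
      assume a: "s \<in> J" "s' \<in> J" "(case s of (s, x) \<Rightarrow> cyc s x) = (case s' of (s, x) \<Rightarrow> cyc s x)"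
      obtain p i x where s: "s = ((p, i), x)" by (metis surj_pair)
      obtain q j w where s': "s' = ((q, j), w)" by (metis surj_pair)
      \<comment> \<open>Equal cycles share this rung, so \<open>disj\<close> also shows that
        different indices give different cycles.\<close>
      have "{rail x p 0, rail (insert i x) p 0} \<in> cycle_edges (cyc (p, i) x)"
        unfolding cyc_def split cycle_edges_ladder[OF zero_less_Suc] by blast
      then show "s = s'" using a unfolding s s' split by (metis disj)
    qed
    then have "card C = card J" unfolding C_def by (rule card_image)
    also have "\<dots> = (\<Sum>s\<in>T. card (Pow ({1..k} - {snd s})))"
      unfolding J_def using finT by (simp add: card_SigmaI)
    also have "\<dots> = (\<Sum>s\<in>T. 2 ^ (k - 1))"
      by (rule sum.cong) (use T(1) in \<open>auto simp: card_Pow\<close>)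
    finally show ?thesis by simp
  qed
  ultimately show ?thesis using finC that by blast
qed

end

section \<open>Choice of the parameters and the final count\<close>

theorem theorem5p5:
  "\<exists>c1 c2 :: real. c1 > 0 \<and> c2 > 0 \<and>
     (\<forall>d k :: nat. 1 \<le> k \<and> real k \<le> c1 * sqrt (real d) \<longrightarrow>
        (\<exists>C :: vertex list set. finite C \<and>
           (\<forall>c \<in> C. is_cycle d c \<and> inconsistent d (Delta k d) c) \<and>
           pairwise (\<lambda>c c'. cycle_edges c \<inter> cycle_edges c' = {}) C \<and>
           real (card C) \<ge> c2 * (real k / real d) * real (card (cube_edges d))))"
\<comment> \<open>The constant \<open>208\<close> is \<open>4 * 13 * 4\<close>: the first
  \<open>4\<close> comes from the central binomial bound and \<open>card_good\<close>,
  \<open>13\<close> from \<open>k + 4 * S \<le> 13 * sqrt m\<close>, and the last \<open>4\<close>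
  from \<open>2 ^ d \<le> 4 * 2 ^ (k - 1) * 4 ^ m\<close>.\<close>
proof (rule exI[of _ "1 / 4"], rule exI[of _ "1 / 208"], intro conjI allI impI)
  fix d k :: nat
  assume dk: "1 \<le> k \<and> real k \<le> 1 / 4 * sqrt (real d)"
  define m where "m = (d - k) div 2"
  \<comment> \<open>This is the least \<open>S\<close> with \<open>3 * m \<le> S\<^sup>2\<close>, as
    \<open>card_good\<close> requires.\<close>
  define S where "S = nat \<lceil>sqrt (3 * real m)\<rceil>"
  have "(4 * real k)\<^sup>2 \<le> (sqrt (real d))\<^sup>2" using dk by (intro power_mono) auto
  then have k2: "16 * k\<^sup>2 \<le> d" by (simp add: power_mult_distrib flip: of_nat_power of_nat_mult)
  moreover have "k \<le> k\<^sup>2" using dk by (simp add: power2_eq_square)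
  moreover have "d - k \<le> Suc (2 * m)" "2 * m \<le> d - k" unfolding m_def by linarith+
  \<comment> \<open>From \<open>16 * k\<^sup>2 \<le> d\<close> follows
    \<open>d - k \<ge> 15\<close>, hence \<open>7 \<le> m\<close>. The bound
    \<open>d \<le> 16 * m\<close> then gives \<open>k \<le> sqrt m\<close>, so \<open>k\<close> is
    of no larger order than the conflict bound.\<close>
  ultimately have m: "7 \<le> m" "k + 2 * m \<le> d" "d \<le> k + 2 * m + 1" "d \<le> 16 * m" using dk by linarith+
  then have "(real k)\<^sup>2 \<le> (sqrt (real m))\<^sup>2" using k2 by (simp flip: of_nat_power)
  then have km: "real k \<le> sqrt (real m)" by (rule power2_le_imp_le) simp
  have "0 \<le> sqrt (3 * real m)" by simp
  then have S_ge: "sqrt (3 * real m) \<le> S" and S_lt: "S < sqrt (3 * real m) + 1"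
    unfolding S_def by linarith+
  have "S \<le> m"
  proof -
    have "sqrt (3 * real m) \<le> sqrt ((real m)\<^sup>2)"
      by (rule real_sqrt_le_mono) (use m in \<open>simp add: power2_eq_square\<close>)
    also have "\<dots> = of_int (int m)" by simp
    finally have "\<lceil>sqrt (3 * real m)\<rceil> \<le> int m" by (simp only: ceiling_le_iff)
    then show ?thesis unfolding S_def nat_le_iff .
  qed
  have "(sqrt (3 * real m))\<^sup>2 \<le> (real S)\<^sup>2" using S_ge by (intro power_mono) auto
  then have S2: "3 * m \<le> S\<^sup>2" by (simp flip: of_nat_power of_nat_mult)
  have "sqrt 3 \<le> 2" by (rule real_le_lsqrt) auto
  then have "sqrt (3 * real m) \<le> 2 * sqrt (real m)" by (simp add: real_sqrt_mult mult_right_mono)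
  moreover have "1 \<le> sqrt (real m)" using m by simp
  ultimately have S_le: "real S \<le> 3 * sqrt (real m)" using S_lt by linarith
  obtain D g where "linked_cube {Suc k..k+2*m} m D g"
    using linked_cube_exists[of "{Suc k..k+2*m}" m] by auto
  then interpret linked_cube "{Suc k..k+2*m}" m D g by assumption
  interpret cube_ladders k m D g d by unfold_locales (use m in linarith)+
  obtain T where T: "T \<subseteq> good S \<times> {1..k}" "inj_on fst T"
    "inj_on (\<lambda>(p, i). (fst p, i)) T" "inj_on (\<lambda>(p, i). (target p, i)) T"
    and cT: "card {1..k} * card (good S) \<le> (card {1..k} + 2 * (2 * S)) * card T"
    by (rule conflict_free_selection[OF finite_good finite_atLeastAtMost
        card_good_same_start card_good_same_target])
  obtain C where C: "finite C" "\<And>c. c \<in> C \<Longrightarrow> is_cycle d c \<and> inconsistent d (Delta k d) c"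
    "pairwise (\<lambda>c c'. cycle_edges c \<inter> cycle_edges c' = {}) C" "card C = card T * 2 ^ (k - 1)"
    using edge_disjoint_cycles[OF T] by blast
  have "real m * 4 ^ m \<le> real m * (2 * sqrt m * ((2 * m) choose m))"
    using central_binomial_sqrt_bound[of m] m by (intro mult_left_mono) auto
  also have "\<dots> = 2 * sqrt m * real (m * ((2 * m) choose m))" by simp
  also have "\<dots> \<le> 2 * sqrt m * real (2 * card (good S))"
    using card_good[OF \<open>S \<le> m\<close> S2] m by (intro mult_left_mono) (auto simp del: of_nat_mult)
  finally have "sqrt m * (sqrt m * 4 ^ m) \<le> sqrt m * (4 * real (card (good S)))"
    by (simp add: algebra_simps flip: mult.assoc)
  then have G: "sqrt m * 4 ^ m \<le> 4 * real (card (good S))"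
    using m by simp
  have "real k * (sqrt m * 4 ^ m) \<le> 4 * (real k * real (card (good S)))"
    using mult_left_mono[OF G, of "real k"] by simp
  also have "\<dots> \<le> 4 * ((real k + 4 * real S) * real (card T))"
    using of_nat_mono[OF cT, where 'a = real] by simp
  also have "\<dots> \<le> 4 * ((13 * sqrt m) * real (card T))"
    using km S_le by (intro mult_left_mono mult_right_mono) auto
  finally have "sqrt m * (real k * 4 ^ m) \<le> sqrt m * (52 * real (card T))" by (simp add: algebra_simps)
  then have T_ge: "real k * 4 ^ m \<le> 52 * real (card T)" using m by simp
  \<comment> \<open>The extra \<open>1\<close> in the exponent allows for odd
    \<open>d - k\<close>.\<close>
  have "(2::real) ^ d \<le> 2 ^ (k + 2 * m + 1)" using m by (intro power_increasing) auto
  also have "\<dots> = 4 * 2 ^ (k - 1) * 4 ^ m" using dk by (cases k) (auto simp: power_add power_mult)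
  finally have "real k * 2 ^ d \<le> (real k * 4 ^ m) * (4 * 2 ^ (k - 1))"
    using mult_left_mono[of "2 ^ d" "4 * 2 ^ (k - 1) * 4 ^ m" "real k"] by (simp add: algebra_simps)
  also have "\<dots> \<le> 52 * real (card T) * (4 * 2 ^ (k - 1))" using T_ge by (rule mult_right_mono) simp
  finally have C_ge: "real k * 2 ^ d \<le> 208 * real (card C)" using C(4) by simp
  have "1 / 208 * (real k / real d) * real (card (cube_edges d)) \<le> 1 / 208 * (real k / real d) * (real d * 2 ^ d)"
    using of_nat_mono[OF card_cube_edges_le[of d], where 'a = real] by (intro mult_left_mono) auto
  also have "\<dots> \<le> real (card C)" using C_ge m by simp
  finally show "\<exists>C. finite C \<and> (\<forall>c \<in> C. is_cycle d c \<and> inconsistent d (Delta k d) c) \<and>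
      pairwise (\<lambda>c c'. cycle_edges c \<inter> cycle_edges c' = {}) C \<and>
      real (card C) \<ge> 1 / 208 * (real k / real d) * real (card (cube_edges d))"
    using C by blast
qed simp_all

end
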